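(* Let $n \geq 6$. Consider the position of $n$-Sim in which exactly three edges are coloured, and for some four distinct vertices $a,b,c,d$ these are: $ab$ and $bc$, coloured green, and $cd$, coloured red; it is PII's turn to move. Then this position is a PII win.
   Context: The game $n$-Sim: the board is the complete graph on $n$ vertices. Two players, PI and PII, alternately colour one previously uncoloured edge, PI moving first; PI colours edges green and PII colours edges red. The first player to complete a triangle all of whose edges are in his own colour loses (the game ends immediately). If all edges are coloured with no monochromatic triangle, the game is a draw (this cannot happen for $n\ge 6$). A position is a partial colouring of the edges by green and red containing no monochromatic triangle. The player to move is determined by the edge counts: PI moves if the numbers of green and red edges are equal, and PII moves if there is exactly one more green edge than red. A position is a "PII win" (respectively "PI win") if PII (respectively PI) has a winning strategy when play continues from that position. *)

theory Defs
  imports Main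
begin

type_synonym edge = "nat set"

definition edges :: "nat \<Rightarrow> edge set" where
  "edges n = {e. e \<subseteq> {..<n} \<and> card e = 2}"

definition has_triangle :: "edge set \<Rightarrow> bool" where
  "has_triangle E \<longleftrightarrow>
     (\<exists>x y z. x \<noteq> y \<and> y \<noteq> z \<and> x \<noteq> z \<and> {x, y} \<in> E \<and> {y, z} \<in> E \<and> {x, z} \<in> E)"

datatype player = Player_I | Player_II

fun opponent :: "player \<Rightarrow> player" where
  "opponent Player_I = Player_II"
| "opponent Player_II = Player_I"

text \<open>
  Any pair of edge sets is a configuration; this includes the final ones, in which a monochromatic
  triangle has been completed. Positions proper are singled out by \<open>is_position\<close>.
\<close>

datatype config = Config (green: "edge set") (red: "edge set")

definition is_position :: "nat \<Rightarrow> config \<Rightarrow> bool" where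
  "is_position n p \<longleftrightarrow>
     green p \<subseteq> edges n \<and> red p \<subseteq> edges n \<and> green p \<inter> red p = {} \<and>
     \<not> has_triangle (green p) \<and> \<not> has_triangle (red p) \<and>
     (card (green p) = card (red p) \<or> card (green p) = card (red p) + 1)"

definition to_move :: "config \<Rightarrow> player" where
  "to_move p = (if card (green p) = card (red p) then Player_I else Player_II)"

definition uncoloured :: "nat \<Rightarrow> config \<Rightarrow> edge set" where
  "uncoloured n p = edges n - (green p \<union> red p)"

fun loses :: "player \<Rightarrow> config \<Rightarrow> bool" where
  "loses Player_I p \<longleftrightarrow> has_triangle (green p)"
| "loses Player_II p \<longleftrightarrow> has_triangle (red p)"

definition game_over :: "nat \<Rightarrow> config \<Rightarrow> bool" where
  "game_over n p \<longleftrightarrow> loses Player_I p \<or> loses Player_II p \<or> uncoloured n p = {}"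

definition colour_edge :: "config \<Rightarrow> edge \<Rightarrow> config" where
  "colour_edge p e =
     (case to_move p of
        Player_I \<Rightarrow> Config (insert e (green p)) (red p)
      | Player_II \<Rightarrow> Config (green p) (insert e (red p)))"

text \<open>
  A play from \<open>p\<close> is the list of the edges coloured so far, in order of play.
\<close>

fun legal_play :: "nat \<Rightarrow> config \<Rightarrow> edge list \<Rightarrow> bool" where
  "legal_play n p [] \<longleftrightarrow> True"
| "legal_play n p (e # es) \<longleftrightarrow>
     \<not> game_over n p \<and> e \<in> uncoloured n p \<and> legal_play n (colour_edge p e) es"

definition after :: "config \<Rightarrow> edge list \<Rightarrow> config" where
  "after p es = foldl colour_edge p es"

text \<open>
  A strategy chooses the next edge from the moves made since the starting position, so it may
  depend on the whole history of the play.
\<close>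

type_synonym strategy = "edge list \<Rightarrow> edge"

definition follows :: "strategy \<Rightarrow> player \<Rightarrow> config \<Rightarrow> edge list \<Rightarrow> bool" where
  "follows \<sigma> P p es \<longleftrightarrow>
     (\<forall>k < length es. to_move (after p (take k es)) = P \<longrightarrow> es ! k = \<sigma> (take k es))"

text \<open>
  The first conjunct makes the strategy supply a legal move whenever one is called for; without it
  a strategy that gets stuck would win vacuously. Every play is finite, and a
  draw counts as a win for neither player.
\<close>

definition winning_strategy :: "nat \<Rightarrow> player \<Rightarrow> config \<Rightarrow> strategy \<Rightarrow> bool" where
  "winning_strategy n P p \<sigma> \<longleftrightarrow>
     (\<forall>es. legal_play n p es \<and> follows \<sigma> P p es \<longrightarrow>
        (\<not> game_over n (after p es) \<and> to_move (after p es) = P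
           \<longrightarrow> \<sigma> es \<in> uncoloured n (after p es)) \<and>
        (game_over n (after p es) \<longrightarrow> loses (opponent P) (after p es)))"

definition win_for :: "player \<Rightarrow> nat \<Rightarrow> config \<Rightarrow> bool" where
  "win_for P n p \<longleftrightarrow> is_position n p \<and> (\<exists>\<sigma>. winning_strategy n P p \<sigma>)"

lemma three_edge_position:
  assumes "distinct [a, b, c, d]" and "{a, b, c, d} \<subseteq> {..<n}"
  defines "p \<equiv> Config {{a, b}, {b, c}} {{c, d}}"
  shows "is_position n p" and "to_move p = Player_II"
proof -
  have cards: "card (green p) = 2" "card (red p) = 1"
    using assms(1) by (auto simp: p_def card_insert_if doubleton_eq_iff)
  have "\<not> has_triangle (green p)" "\<not> has_triangle (red p)"
    unfolding has_triangle_def p_def using assms(1) by (auto simp: doubleton_eq_iff)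
  then show "is_position n p"
    using assms(1,2) cards by (auto simp: is_position_def p_def edges_def doubleton_eq_iff)
  show "to_move p = Player_II"
    using cards by (simp add: to_move_def)
qed

end

theory Submission
  imports Defs
begin

text \<open>
  Strategy stealing. PII colours \<open>bd\<close> red. If PI, to move, now loses, we are done. Otherwise the player
  to move wins when owning \<open>ab, bc\<close> against \<open>cd, bd\<close>. Here \<open>bc\<close> is unplayable for the opponent, as
  \<open>cd\<close> and \<open>bd\<close> are his; having played it is no better than keeping it as a spare move, so the mover
  also wins when owning only \<open>ab\<close> against \<open>cd, bd\<close>. Up to renaming vertices this is the original
  position. Draws are excluded by \<open>R(3,3) = 6\<close>.
\<close>

section \<open>The game from the point of view of the player to move\<close>

lemma finite_edges [simp]: "finite (edges n)"
  by (rule finite_subset[of _ "Pow {..<n}"]) (auto simp: edges_def)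

lemma has_triangle_mono: "has_triangle E \<Longrightarrow> E \<subseteq> F \<Longrightarrow> has_triangle F"
  unfolding has_triangle_def by blast

lemma has_triangleI:
  "x \<noteq> y \<Longrightarrow> y \<noteq> z \<Longrightarrow> x \<noteq> z \<Longrightarrow> {x, y} \<in> E \<Longrightarrow> {y, z} \<in> E \<Longrightarrow> {x, z} \<in> E \<Longrightarrow> has_triangle E"
  unfolding has_triangle_def by (intro exI conjI)

text \<open>The number of free edges is the measure for the termination proof and for both
  inductions on \<open>mover_wins\<close>. The equation for \<open>D\<close> covers either colour
  receiving \<open>e\<close>.\<close>

lemma card_free_edges_less:
  assumes "e \<in> edges n - C" "D = insert e C"
  shows "card (edges n - D) < card (edges n - C)"
  by (rule psubset_card_mono) (use assms in auto)

text \<open>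
  The player to move owns \<open>A\<close>, the opponent \<open>B\<close>. A player without a safe move loses, even when no
  edge is left; for \<open>n \<ge> 6\<close> this is harmless, as there are no draws.
\<close>

function mover_wins :: "nat \<Rightarrow> edge set \<Rightarrow> edge set \<Rightarrow> bool" where
  "mover_wins n A B \<longleftrightarrow>
     (\<exists>e \<in> edges n - (A \<union> B). \<not> has_triangle (insert e A) \<and> \<not> mover_wins n B (insert e A))"
  by auto
termination
  by (relation "measure (\<lambda>(n, A, B). card (edges n - (A \<union> B)))")
     (simp, simp only: in_measure prod.case, rule card_free_edges_less, assumption, blast)

declare mover_wins.simps [simp del]

lemma mover_winsI:
  assumes "e \<in> edges n - (A \<union> B)" "\<not> has_triangle (insert e A)" "\<not> mover_wins n B (insert e A)"
  shows "mover_wins n A B"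
  using assms by (subst mover_wins.simps) blast

lemma mover_winsE:
  assumes "mover_wins n A B"
  obtains e where "e \<in> edges n - (A \<union> B)" "\<not> has_triangle (insert e A)"
    "\<not> mover_wins n B (insert e A)"
  using assms by (subst (asm) mover_wins.simps) blast

text \<open>The owner of \<open>B\<close> can never colour \<open>e\<close> without losing, so the
  owner of \<open>A\<close> can copy the moves from the position in which \<open>e\<close> is
  already his. The two halves, one for each player on turn, feed each other in the
  induction.\<close>

lemma mover_wins_spare_move_aux:
  assumes "has_triangle (insert e B)"
  shows "(mover_wins n (insert e A) B \<longrightarrow> mover_wins n A B) \<and>
         (mover_wins n B A \<longrightarrow> mover_wins n B (insert e A))"
  using assms
proof (induction "card (edges n - (A \<union> B))" arbitrary: A B rule: less_induct)
  case less
  \<comment> \<open>Covers a move \<open>f\<close> by either player; \<open>B'\<close> only grows,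
    so \<open>e\<close> stays unplayable for its owner.\<close>
  have IH: "(mover_wins n (insert e A') B' \<longrightarrow> mover_wins n A' B') \<and>
         (mover_wins n B' A' \<longrightarrow> mover_wins n B' (insert e A'))"
    if "f \<in> edges n - (A \<union> B)" "A' \<union> B' = insert f (A \<union> B)" "B \<subseteq> B'" for f A' B'
  proof (rule less.hyps)
    show "card (edges n - (A' \<union> B')) < card (edges n - (A \<union> B))"
      using that by (intro card_free_edges_less)
    show "has_triangle (insert e B')"
      using less.prems that(3) by (auto elim: has_triangle_mono)
  qed
  show ?case
  proof (intro conjI impI)
    assume "mover_wins n (insert e A) B"
    then obtain f where f: "f \<in> edges n - (insert e A \<union> B)" "\<not> has_triangle (insert f (insert e A))"
      "\<not> mover_wins n B (insert f (insert e A))"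
      by (rule mover_winsE)
    then have "\<not> mover_wins n B (insert f A)"
      using IH[of f "insert f A" B] by (auto simp: insert_commute)
    moreover have "\<not> has_triangle (insert f A)"
      using f(2) has_triangle_mono[of "insert f A" "insert f (insert e A)"] by auto
    ultimately show "mover_wins n A B"
      using f(1) by (intro mover_winsI[of f]) auto
  next
    assume "mover_wins n B A"
    then obtain f where f: "f \<in> edges n - (B \<union> A)" "\<not> has_triangle (insert f B)"
      "\<not> mover_wins n A (insert f B)"
      by (rule mover_winsE)
    then have "\<not> mover_wins n (insert e A) (insert f B)"
      using IH[of f A "insert f B"] by auto
    \<comment> \<open>The move \<open>f\<close> is safe while \<open>e\<close> would complete a
      triangle, so \<open>f\<close> is still free once \<open>e\<close> belongs to
      \<open>A\<close>.\<close>
    moreover have "f \<noteq> e"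
      using f(2) less.prems by auto
    ultimately show "mover_wins n B (insert e A)"
      using f by (intro mover_winsI[of f]) auto
  qed
qed

lemma mover_wins_spare_move:
  "mover_wins n (insert e A) B \<Longrightarrow> has_triangle (insert e B) \<Longrightarrow> mover_wins n A B"
  using mover_wins_spare_move_aux by blast

section \<open>Renaming the vertices\<close>

lemma has_triangle_image:
  assumes "inj f"
  shows "has_triangle ((`) f ` E) \<longleftrightarrow> has_triangle E"
proof
  assume "has_triangle ((`) f ` E)"
  then obtain x y z where xyz: "x \<noteq> y" "y \<noteq> z" "x \<noteq> z"
    "{x, y} \<in> (`) f ` E" "{y, z} \<in> (`) f ` E" "{x, z} \<in> (`) f ` E"
    unfolding has_triangle_def by blast
  have "u \<in> range f \<and> v \<in> range f" if "{u, v} \<in> (`) f ` E" for u v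
  proof -
    obtain e where "{u, v} = f ` e"
      using \<open>{u, v} \<in> (`) f ` E\<close> by (elim imageE)
    then show ?thesis by blast
  qed
  then have "x \<in> range f" "y \<in> range f" "z \<in> range f"
    using xyz(4,5) by simp_all
  then obtain x' y' z' where pre: "x = f x'" "y = f y'" "z = f z'"
    unfolding image_iff by auto
  have "{u, v} \<in> E" if uv: "{f u, f v} \<in> (`) f ` E" for u v
  proof -
    obtain e where "e \<in> E" "f ` {u, v} = f ` e"
      using uv by auto
    then show ?thesis
      using inj_image_eq_iff[OF assms] by metis
  qed
  then have "{x', y'} \<in> E" "{y', z'} \<in> E" "{x', z'} \<in> E"
    using xyz(4-6) by (simp_all only: pre)
  moreover have "x' \<noteq> y'" "y' \<noteq> z'" "x' \<noteq> z'"
    using xyz(1-3) by (auto simp: pre)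
  ultimately show "has_triangle E"
    by (intro has_triangleI)
next
  assume "has_triangle E"
  then obtain x y z where "x \<noteq> y" "y \<noteq> z" "x \<noteq> z" "{x, y} \<in> E" "{y, z} \<in> E" "{x, z} \<in> E"
    unfolding has_triangle_def by blast
  moreover have "{f u, f v} \<in> (`) f ` E" if "{u, v} \<in> E" for u v
    using imageI[OF that, of "(`) f"] by simp
  ultimately show "has_triangle ((`) f ` E)"
    using assms by (intro has_triangleI[of "f x" "f y" "f z"]) (auto dest: injD)
qed

lemma edges_image:
  assumes "inj f" "f ` {..<n} = {..<n}"
  shows "(`) f ` edges n = edges n"
proof (rule card_subset_eq)
  show "(`) f ` edges n \<subseteq> edges n"
    using assms by (auto simp: edges_def card_image inj_on_subset)
  have "inj_on ((`) f) (edges n)"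
    using assms(1) by (auto simp: inj_on_def inj_image_eq_iff)
  then show "card ((`) f ` edges n) = card (edges n)"
    by (rule card_image)
qed simp

text \<open>A permutation of the board's vertices carries free edges to free edges and, being
  injective, preserves and reflects triangles; so both sides unfold to the same recursion.\<close>

lemma mover_wins_image:
  assumes "inj f" "f ` {..<n} = {..<n}"
  shows "mover_wins n ((`) f ` A) ((`) f ` B) \<longleftrightarrow> mover_wins n A B"
proof (induction "card (edges n - (A \<union> B))" arbitrary: A B rule: less_induct)
  case less
  let ?g = "(`) f"
  have inj: "inj ?g"
    using assms(1) by (auto simp: inj_on_def inj_image_eq_iff)
  have free: "edges n - (?g ` A \<union> ?g ` B) = ?g ` (edges n - (A \<union> B))"
    using edges_image[OF assms] by (simp add: image_set_diff[OF inj] image_Un)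
  have IH: "mover_wins n (?g ` B) (?g ` insert e A) \<longleftrightarrow> mover_wins n B (insert e A)"
    if "e \<in> edges n - (A \<union> B)" for e
    by (rule less.hyps, rule card_free_edges_less, rule that) blast
  have tri: "has_triangle (?g ` insert e A) \<longleftrightarrow> has_triangle (insert e A)" for e
    by (rule has_triangle_image[OF assms(1)])
  have "mover_wins n (?g ` A) (?g ` B) \<longleftrightarrow>
      (\<exists>e \<in> edges n - (A \<union> B). \<not> has_triangle (?g ` insert e A) \<and>
         \<not> mover_wins n (?g ` B) (?g ` insert e A))"
    by (subst mover_wins.simps) (simp only: free bex_simps image_insert)
  also have "\<dots> \<longleftrightarrow> mover_wins n A B"
    by (subst (2) mover_wins.simps) (simp only: tri IH cong: bex_cong)
  finally show ?case .
qed

section \<open>The strategy-stealing argument\<close>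

lemma mover_wins_three_edges:
  assumes "{a, b, c, d} \<subseteq> {..<n}" "distinct [a, b, c, d]"
  shows "mover_wins n {{c, d}} {{a, b}, {b, c}}"
proof (rule ccontr)
  assume lose: "\<not> mover_wins n {{c, d}} {{a, b}, {b, c}}"
  have "mover_wins n {{a, b}, {b, c}} {{c, d}, {b, d}}"
  proof (rule ccontr)
    assume *: "\<not> mover_wins n {{a, b}, {b, c}} {{c, d}, {b, d}}"
    have "\<not> has_triangle {{b, d}, {c, d}}"
      unfolding has_triangle_def using assms(2) by (auto simp: doubleton_eq_iff)
    then have "mover_wins n {{c, d}} {{a, b}, {b, c}}"
      using assms * by (intro mover_winsI[of "{b, d}"])
        (auto simp: edges_def doubleton_eq_iff insert_commute)
    with lose show False ..
  qed
  then have "mover_wins n (insert {b, c} {{a, b}}) {{c, d}, {b, d}}"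
    by (simp add: insert_commute)
  moreover have "has_triangle (insert {b, c} {{c, d}, {b, d}})"
    unfolding has_triangle_def using assms(2)
    by (intro exI[of _ b] exI[of _ c] exI[of _ d]) auto
  ultimately have win: "mover_wins n {{a, b}} {{c, d}, {b, d}}"
    by (rule mover_wins_spare_move)
  \<comment> \<open>The opponent's path \<open>c\<close>, \<open>d\<close>, \<open>b\<close> with
    the mover's edge \<open>ab\<close> hanging at its end \<open>b\<close> is sent to the path
    \<open>a\<close>, \<open>b\<close>, \<open>c\<close> with \<open>dc\<close> hanging at
    \<open>c\<close>, which is the starting position.\<close>
  define f where "f = id(a := d, b := c, c := a, d := b)"
  have "inj f"
    using assms(2) unfolding f_def inj_def by auto
  moreover have "f ` {..<n} = {..<n}"
  proof (rule card_subset_eq)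
    show "f ` {..<n} \<subseteq> {..<n}"
      using assms(1) by (auto simp: f_def)
    show "card (f ` {..<n}) = card {..<n}"
      using \<open>inj f\<close> by (intro card_image) (auto intro: inj_on_subset)
  qed simp
  ultimately have "mover_wins n ((`) f ` {{a, b}}) ((`) f ` {{c, d}, {b, d}})"
    using win by (simp only: mover_wins_image)
  moreover have "f a = d" "f b = c" "f c = a" "f d = b"
    using assms(2) by (auto simp: f_def)
  ultimately have "mover_wins n {{d, c}} {{a, b}, {c, b}}"
    by simp
  with lose show False
    by (simp add: insert_commute)
qed

section \<open>No draws\<close>

text \<open>Pigeonhole; the five numbers will be the neighbours of vertex \<open>0\<close> in the
  complete graph on six vertices.\<close>

lemma three_of_five:
  fixes P :: "nat \<Rightarrow> bool"
  obtains x y z where "{x, y, z} \<subseteq> {1..5}" "distinct [x, y, z]" "P x = P y" "P y = P z"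
proof -
  let ?A = "\<lambda>b. {i \<in> {1..5}. P i = b}"
  have "?A True \<union> ?A False = {1..5}" "?A True \<inter> ?A False = {}"
    by auto
  then have "card (?A True) + card (?A False) = card {1..5::nat}"
    by (metis (no_types, lifting) card_Un_disjoint finite_Un finite_atLeastAtMost)
  then have "3 \<le> card (?A True) \<or> 3 \<le> card (?A False)"
    unfolding card_atLeastAtMost by linarith
  then obtain b where "3 \<le> card (?A b)"
    by (rule disjE) (erule that)+
  then obtain T where T: "T \<subseteq> ?A b" "card T = 3"
    by (rule obtain_subset_with_card_n)
  then obtain x y z where "T = {x, y, z}" "x \<noteq> y" "y \<noteq> z" "x \<noteq> z"
    by (auto simp: card_3_iff)
  with T(1) show ?thesis
    by (intro that[of x y z]) auto
qed

text \<open>The classical argument: three edges from vertex \<open>0\<close> share a colour. Either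
  an edge between their far ends has it too, or those far ends span a triangle in the other
  colour.\<close>

lemma two_coloured_triangle:
  assumes "n \<ge> 6" "edges n \<subseteq> G \<union> R"
  shows "has_triangle G \<or> has_triangle R"
proof -
  have edge: "{x, y} \<in> G \<or> {x, y} \<in> R" if "x \<noteq> y" "x < 6" "y < 6" for x y
    using assms that by (auto simp: edges_def subset_iff)
  obtain x y z where xyz: "{x, y, z} \<subseteq> {1..5}" "distinct [x, y, z]"
    "({0, x} \<in> G) = ({0, y} \<in> G)" "({0, y} \<in> G) = ({0, z} \<in> G)"
    using three_of_five[of "\<lambda>i. {0, i} \<in> G"] by metis
  \<comment> \<open>Stated for abstract colours, to be used with \<open>G\<close> and
    \<open>R\<close> in either order.\<close>
  have mono: "has_triangle C \<or> has_triangle D"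
    if "{0, x} \<in> C" "{0, y} \<in> C" "{0, z} \<in> C"
      and "\<And>u v. u \<noteq> v \<Longrightarrow> u < 6 \<Longrightarrow> v < 6 \<Longrightarrow> {u, v} \<in> C \<or> {u, v} \<in> D" for C D :: "edge set"
  proof -
    have "{x, y} \<in> C \<or> {x, y} \<in> D" "{y, z} \<in> C \<or> {y, z} \<in> D" "{x, z} \<in> C \<or> {x, z} \<in> D"
      using xyz that(4) by auto
    moreover have "x \<noteq> 0" "y \<noteq> 0" "z \<noteq> 0" "x \<noteq> y" "y \<noteq> z" "x \<noteq> z"
      using xyz by auto
    ultimately show ?thesis
      using that(1-3) has_triangleI[of 0 x y C] has_triangleI[of 0 y z C] has_triangleI[of 0 x z C]
        has_triangleI[of x y z D] by auto
  qed
  show ?thesis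
  proof (cases "{0, x} \<in> G")
    case True
    then show ?thesis using xyz edge by (intro mono) auto
  next
    case False
    have "has_triangle R \<or> has_triangle G"
    proof (rule mono)
      show "{0, x} \<in> R" "{0, y} \<in> R" "{0, z} \<in> R"
        using False xyz edge[of 0 x] edge[of 0 y] edge[of 0 z] by auto
    qed (use edge in blast)
    then show ?thesis by blast
  qed
qed

section \<open>Extracting a strategy for PII\<close>

lemma after_snoc [simp]: "after p (es @ [e]) = colour_edge (after p es) e"
  by (simp add: after_def)

lemma legal_play_snoc:
  "legal_play n p (es @ [e]) \<longleftrightarrow>
     legal_play n p es \<and> \<not> game_over n (after p es) \<and> e \<in> uncoloured n (after p es)"
  by (induction es arbitrary: p) (auto simp: after_def)

lemma follows_snoc:
  "follows \<sigma> P p (es @ [e]) \<longleftrightarrow>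
     follows \<sigma> P p es \<and> (to_move (after p es) = P \<longrightarrow> e = \<sigma> es)"
  unfolding follows_def by (auto simp: nth_append less_Suc_eq)

text \<open>These are the witnesses in the recursion for \<open>mover_wins\<close> when PII is on
  turn.\<close>

definition winning_reply :: "nat \<Rightarrow> config \<Rightarrow> edge \<Rightarrow> bool" where
  "winning_reply n q e \<longleftrightarrow> e \<in> uncoloured n q \<and> \<not> has_triangle (insert e (red q)) \<and>
     \<not> mover_wins n (green q) (insert e (red q))"

text \<open>The invariant of plays in which PII follows the strategy. It includes final
  configurations, hence the alternative of a green triangle; the condition on the counts makes
  \<open>to_move\<close> alternate.\<close>

definition favours_II :: "nat \<Rightarrow> config \<Rightarrow> bool" where
  "favours_II n q \<longleftrightarrow> green q \<union> red q \<subseteq> edges n \<and>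
     (card (green q) = card (red q) \<or> card (green q) = card (red q) + 1) \<and>
     \<not> has_triangle (red q) \<and>
     (has_triangle (green q) \<or>
      (if to_move q = Player_II then mover_wins n (red q) (green q)
       else \<not> mover_wins n (green q) (red q)))"

lemma favours_II_imp_reply:
  assumes "favours_II n q" "to_move q = Player_II" "\<not> game_over n q"
  shows "\<exists>e. winning_reply n q e"
proof -
  have "mover_wins n (red q) (green q)"
    using assms by (auto simp: favours_II_def game_over_def)
  then show ?thesis
    by (rule mover_winsE) (auto simp: winning_reply_def uncoloured_def)
qed

lemma favours_II_colour_edge:
  assumes fav: "favours_II n q" and "\<not> game_over n q" and e: "e \<in> uncoloured n q"
    and reply: "to_move q = Player_II \<Longrightarrow> winning_reply n q e"
  shows "favours_II n (colour_edge q e)"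
proof -
  have fin: "finite (green q)" "finite (red q)"
    using fav by (auto simp: favours_II_def intro: finite_subset[OF _ finite_edges])
  have e': "e \<in> edges n" "e \<notin> green q" "e \<notin> red q"
    using e by (auto simp: uncoloured_def)
  show ?thesis
  proof (cases "to_move q")
    case Player_I
    then have eq: "card (green q) = card (red q)"
      by (auto simp: to_move_def split: if_splits)
    have lose: "\<not> mover_wins n (green q) (red q)"
      using fav assms(2) Player_I by (auto simp: favours_II_def game_over_def)
    \<comment> \<open>Otherwise \<open>e\<close> would be a winning move for PI. If \<open>e\<close>
      completes a green triangle, the invariant holds by its first alternative.\<close>
    have "mover_wins n (red q) (insert e (green q))" if "\<not> has_triangle (insert e (green q))"
      using lose that e' by (auto intro: mover_winsI)
    then show ?thesis
      using fav Player_I eq fin e' by (auto simp: favours_II_def colour_edge_def to_move_def)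
  next
    case Player_II
    then have "card (green q) = card (red q) + 1"
      using fav by (auto simp: to_move_def favours_II_def split: if_splits)
    then show ?thesis
      using fav Player_II reply fin e'
      by (auto simp: favours_II_def colour_edge_def to_move_def winning_reply_def)
  qed
qed

text \<open>Choosing any winning reply to the current configuration maintains the invariant, which
  excludes red triangles; so only a green triangle can end the game.\<close>

lemma favours_II_imp_winning_strategy:
  assumes "n \<ge> 6" "favours_II n p"
  shows "winning_strategy n Player_II p (\<lambda>es. SOME e. winning_reply n (after p es) e)"
    (is "winning_strategy n Player_II p ?\<sigma>")
proof -
  have reply: "winning_reply n (after p es) (?\<sigma> es)"
    if "favours_II n (after p es)" "to_move (after p es) = Player_II" "\<not> game_over n (after p es)" for es
    using favours_II_imp_reply[OF that] by (rule someI_ex)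
  have fav: "favours_II n (after p es)" if "legal_play n p es" "follows ?\<sigma> Player_II p es" for es
    using that
  proof (induction es rule: rev_induct)
    case Nil
    then show ?case using assms(2) by (simp add: after_def)
  next
    case (snoc e es)
    then show ?case
      using favours_II_colour_edge reply by (auto simp: legal_play_snoc follows_snoc)
  qed
  \<comment> \<open>A full board contains a monochromatic triangle, which cannot be red; this is
    where \<open>n \<ge> 6\<close> enters.\<close>
  have "loses Player_I q" if "favours_II n q" "game_over n q" for q
    using that two_coloured_triangle[OF assms(1), of "green q" "red q"]
    by (auto simp: favours_II_def game_over_def uncoloured_def)
  moreover have "e \<in> uncoloured n q" if "winning_reply n q e" for q e
    using that by (simp add: winning_reply_def)
  ultimately show ?thesis
    unfolding winning_strategy_def opponent.simps using fav reply by blast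
qed

theorem theorem3:
  fixes n a b c d :: nat
  assumes "n \<ge> 6"
    and "{a, b, c, d} \<subseteq> {..<n}"
    and "distinct [a, b, c, d]"
  shows "win_for Player_II n (Config {{a, b}, {b, c}} {{c, d}})"
proof -
  let ?p = "Config {{a, b}, {b, c}} {{c, d}}"
  have pos: "is_position n ?p" and turn: "to_move ?p = Player_II"
    using three_edge_position[OF assms(3,2)] .
  have "favours_II n ?p"
    using pos turn mover_wins_three_edges[OF assms(2,3)] by (auto simp: favours_II_def is_position_def)
  then show ?thesis
    using pos favours_II_imp_winning_strategy[OF assms(1)] unfolding win_for_def by blast
qed

end
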